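(* For every $k\ge 3$ and every $q\ge 2$ there are positive constants $c,c'$ depending only on $k$ and $q$ such that for every integer $n\ge 4k$, $$t_{k-1}(c\,n^{q-1})\le N_k(q,n)\le t_{k-1}(c'\,n^{q-1}\log_2 n).$$
   Context: For integers $k\ge 1$, $q\ge 1$, $n\ge k$, a monotone (tight) path of length $n$ in the complete $k$-uniform hypergraph on $[N]=\{1,\dots,N\}$ is given by integers $j_1<\dots<j_n$ in $[N]$ together with the $k$-sets $\{j_i,\dots,j_{i+k-1}\}$, $i=1,\dots,n-k+1$. $N_k(q,n)$ is the smallest $N$ such that every $q$-coloring of the $k$-element subsets of $[N]$ contains a monotone path of length $n$ all of whose $k$-sets have the same color. The tower function is defined by $t_1(x)=x$ and $t_{i+1}(x)=2^{t_i(x)}$. *)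

theory Defs
  imports Complex_Main "HOL-Library.Ramsey" "HOL-Library.FuncSet"
begin

text \<open>A path of length \<open>n\<close> has \<open>n\<close> vertices \<open>j 1 < \<dots> < j n\<close>; its edges are the sets of
  \<open>k\<close> consecutive vertices.\<close>

definition monotone_path :: "nat \<Rightarrow> nat \<Rightarrow> (nat \<Rightarrow> nat) \<Rightarrow> bool" where
  "monotone_path N n j \<longleftrightarrow> strict_mono_on {1..n} j \<and> j ` {1..n} \<subseteq> {1..N}"

definition path_edges :: "nat \<Rightarrow> nat \<Rightarrow> (nat \<Rightarrow> nat) \<Rightarrow> nat set set" where
  "path_edges k n j = (\<lambda>i. j ` {i..i + k - 1}) ` {1..n - k + 1}"

definition forces_mono_path :: "nat \<Rightarrow> nat \<Rightarrow> nat \<Rightarrow> nat \<Rightarrow> bool" where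
  "forces_mono_path k q n N \<longleftrightarrow>
     (\<forall>\<chi> \<in> [{1..N}]\<^bsup>k\<^esup> \<rightarrow> {1..q}.
        \<exists>j. monotone_path N n j \<and> (\<exists>a. \<forall>e \<in> path_edges k n j. \<chi> e = a))"

definition mono_path_number :: "nat \<Rightarrow> nat \<Rightarrow> nat \<Rightarrow> nat" where
  "mono_path_number k q n = (LEAST N. forces_mono_path k q n N)"

text \<open>Only indices \<open>i \<ge> 1\<close> are meaningful; the value at index \<open>0\<close> is a dummy.\<close>

fun tower :: "nat \<Rightarrow> real \<Rightarrow> real" where
  "tower 0 x = x"
| "tower (Suc 0) x = x"
| "tower (Suc (Suc i)) x = 2 powr tower (Suc i) x"

text \<open>By Ramsey's theorem the minimum defining \<open>mono_path_number\<close> is attained.\<close>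

lemma forces_mono_path_exists:
  assumes "1 \<le> k" "k \<le> n"
  shows "\<exists>N. forces_mono_path k q n N"
proof -
  obtain N :: nat where N: "partn_lst {..<N} (replicate q n) k"
    using ramsey_full by blast
  have "forces_mono_path k q n N"
    unfolding forces_mono_path_def
  proof
    fix \<chi> assume \<chi>: "\<chi> \<in> [{1..N}]\<^bsup>k\<^esup> \<rightarrow> {1..q}"
    define g where "g X = \<chi> (Suc ` X) - 1" for X
    have im: "Suc ` X \<in> [{1..N}]\<^bsup>k\<^esup>" if "X \<in> [{..<N}]\<^bsup>k\<^esup>" for X
      using that by (auto simp: nsets_def card_image)
    have \<chi>im: "\<chi> (Suc ` X) \<in> {1..q}" if "X \<in> [{..<N}]\<^bsup>k\<^esup>" for X
      using \<chi> im[OF that] by blast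
    have "g \<in> [{..<N}]\<^bsup>k\<^esup> \<rightarrow> {..<length (replicate q n)}"
    proof
      fix X assume "X \<in> [{..<N}]\<^bsup>k\<^esup>"
      from \<chi>im[OF this] show "g X \<in> {..<length (replicate q n)}"
        by (auto simp: g_def)
    qed
    then obtain a where a: "a < q" "monochromatic {..<N} n k g a"
      using N unfolding partn_lst_def by (metis length_replicate nth_replicate)
    then obtain H where H: "H \<subseteq> {..<N}" "finite H" "card H = n" "g ` [H]\<^bsup>k\<^esup> \<subseteq> {a}"
      unfolding monochromatic_def nsets_def by auto
    define h where "h i = sorted_list_of_set H ! (i - 1)" for i
    define j where "j = Suc \<circ> h"
    have len: "length (sorted_list_of_set H) = n"
      using H by simp
    have hH: "h i \<in> H" if "i \<in> {1..n}" for i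
      using that len H nth_mem[of "i - 1" "sorted_list_of_set H"] by (auto simp: h_def)
    have hmono: "strict_mono_on {1..n} h"
    proof (rule strict_mono_onI)
      fix r s assume "r \<in> {1..n}" "s \<in> {1..n}" "r < s"
      then have "r - 1 < s - 1" "s - 1 < length (sorted_list_of_set H)"
        using len by auto
      then show "h r < h s"
        unfolding h_def by (rule sorted_wrt_nth_less[OF strict_sorted_list_of_set])
    qed
    have "monotone_path N n j"
      unfolding monotone_path_def
    proof
      show "strict_mono_on {1..n} j"
        using hmono by (simp add: j_def strict_mono_on_def)
      show "j ` {1..n} \<subseteq> {1..N}"
        using hH H(1) by (fastforce simp: j_def)
    qed
    moreover have "\<chi> e = Suc a" if e: "e \<in> path_edges k n j" for e
    proof -
      obtain i where i: "i \<in> {1..n - k + 1}" "e = j ` {i..i + k - 1}"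
        using e unfolding path_edges_def by blast
      let ?I = "{i..i + k - 1}"
      have sub: "?I \<subseteq> {1..n}"
        using i assms by auto
      have "inj_on h ?I"
        using strict_mono_on_imp_inj_on[OF hmono] sub inj_on_subset by blast
      then have "card (h ` ?I) = k"
        using assms by (simp add: card_image)
      then have hI: "h ` ?I \<in> [H]\<^bsup>k\<^esup>"
        using hH sub by (auto simp: nsets_def subset_iff)
      then have "g (h ` ?I) = a"
        using H(4) by blast
      moreover have "\<chi> (Suc ` h ` ?I) \<in> {1..q}"
        using \<chi>im hI nsets_mono[OF H(1)] by blast
      moreover have "e = Suc ` h ` ?I"
        using i by (simp add: j_def image_comp)
      ultimately show ?thesis
        by (auto simp: g_def)
    qed
    ultimately show "\<exists>j. monotone_path N n j \<and> (\<exists>a. \<forall>e \<in> path_edges k n j. \<chi> e = a)"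
      by blast
  qed
  then show ?thesis ..
qed

end

theory Submission
  imports Defs "HOL-Library.Nat_Bijection"
begin

text \<open>
  Put \<open>m = n - k + 1\<close> and let \<open>P\<close> be the disjoint union of \<open>q\<close> chains of size \<open>m - 1\<close>. A coloring
  of the \<open>k\<close>-sets of \<open>[N]\<close> has no monochromatic path of length \<open>n\<close> iff one can map each \<open>k\<close>-set
  to \<open>P\<close> (its color, and the number of edges of a longest monochromatic path ending in it) such
  that the image of an edge is never above the image of the next edge. Replacing \<open>P\<close> by its
  poset of down-sets lowers the uniformity by one, and for uniformity one such a map exists iff
  \<open>N\<close> is at most the size of the poset. Hence \<open>N_k(q,n)\<close> is one more than the size of the
  \<open>(k-1)\<close>-fold iterated poset of down-sets of \<open>P\<close>.

  The first iterate is the grid \<open>[m]^q\<close>. It is covered by \<open>m^(q-1)\<close> chains of size \<open>m\<close>, so it has at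
  most \<open>(m+1)^(m^(q-1))\<close> down-sets; every further iteration at most exponentiates the size. One
  of its layers is an antichain of size at least \<open>m^(q-1)/(q-1)\<close>. An antichain of size \<open>w\<close> yields
  \<open>2^w\<close> down-sets and, through its subsets of size \<open>w div 2\<close>, an antichain of at least
  \<open>2^(w div 2)\<close> down-sets, which gives the lower bound.
\<close>

section \<open>Increasing lists and homomorphisms into set families\<close>

text \<open>A \<open>k\<close>-set is written as an increasing list, so that \<open>butlast\<close>
  and \<open>tl\<close> of a list of length \<open>k + 1\<close> are two consecutive edges of a
  path.\<close>

definition incr :: "nat \<Rightarrow> nat \<Rightarrow> nat list set" where
  "incr N k = {xs. sorted_wrt (<) xs \<and> length xs = k \<and> set xs \<subseteq> {1..N}}"

text \<open>A homomorphism from the shift digraph, with arcs from \<open>butlast xs\<close> to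
  \<open>tl xs\<close>, to the digraph on \<open>F\<close> with an arc from \<open>X\<close> to
  \<open>Y\<close> unless \<open>Y \<subseteq> X\<close>.\<close>

definition fam_hom :: "nat \<Rightarrow> nat \<Rightarrow> nat set set \<Rightarrow> (nat list \<Rightarrow> nat set) \<Rightarrow> bool" where
  "fam_hom N k F f \<longleftrightarrow> (\<forall>xs\<in>incr N k. f xs \<in> F) \<and>
     (\<forall>xs\<in>incr N (Suc k). \<not> f (tl xs) \<subseteq> f (butlast xs))"

definition downclosed :: "nat set set \<Rightarrow> nat set set \<Rightarrow> bool" where
  "downclosed F D \<longleftrightarrow> D \<subseteq> F \<and> (\<forall>X\<in>D. \<forall>Y\<in>F. Y \<subseteq> X \<longrightarrow> Y \<in> D)"

text \<open>Posets are represented as families of finite sets of naturals ordered by inclusion;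
  \<open>set_encode\<close> keeps the type fixed, so that passing to down-sets can be iterated.\<close>

definition down_fam :: "nat set set \<Rightarrow> nat set set" where
  "down_fam F = (\<lambda>D. set_encode ` D) ` {D. downclosed F D}"

definition finite_fam :: "nat set set \<Rightarrow> bool" where
  "finite_fam F \<longleftrightarrow> finite F \<and> (\<forall>X\<in>F. finite X)"

lemma incr_tl: "xs \<in> incr N (Suc k) \<Longrightarrow> tl xs \<in> incr N k"
  by (cases xs) (auto simp: incr_def)

lemma incr_take: "xs \<in> incr N k \<Longrightarrow> i \<le> k \<Longrightarrow> take i xs \<in> incr N i"
  unfolding incr_def by (auto simp: sorted_wrt_take dest: in_set_takeD)

lemma incr_drop: "xs \<in> incr N k \<Longrightarrow> drop i xs \<in> incr N (k - i)"
  unfolding incr_def by (auto simp: sorted_wrt_drop dest: in_set_dropD)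

lemma incr_butlast: "xs \<in> incr N (Suc k) \<Longrightarrow> butlast xs \<in> incr N k"
  using incr_take[of xs N "Suc k" k] by (simp add: butlast_conv_take incr_def)

text \<open>As \<open>k \<ge> 1\<close>, \<open>butlast zs\<close> begins with the first entry of
  \<open>zs\<close>, so the first tuple already puts \<open>x\<close> below that entry.\<close>

lemma incr_Cons_glue:
  assumes "x # butlast zs \<in> incr N (Suc k)" "zs \<in> incr N (Suc k)" "k \<ge> 1"
  shows "x # zs \<in> incr N (Suc (Suc k))"
proof -
  obtain y ys where zs: "zs = y # ys" "ys \<noteq> []" using assms
    by (cases zs; cases "tl zs") (auto simp: incr_def)
  then have "x < y" using assms(1) by (auto simp: incr_def)
  then show ?thesis using assms zs by (auto simp: incr_def)
qed

lemma sorted_list_of_set_incr: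
  assumes "xs \<in> incr N k" shows "sorted_list_of_set (set xs) = xs"
  using assms by (auto simp: incr_def strict_sorted_iff sorted_list_of_set.idem_if_sorted_distinct)

lemma set_incr_nsets:
  assumes "xs \<in> incr N k" shows "set xs \<in> [{1..N}]\<^bsup>k\<^esup>"
  using assms by (auto simp: incr_def strict_sorted_iff nsets_def distinct_card)

lemma inj_on_image_subset:
  assumes "inj_on f C" "D \<subseteq> C" "E \<subseteq> C"
  shows "f ` D \<subseteq> f ` E \<longleftrightarrow> D \<subseteq> E"
proof
  assume sub: "f ` D \<subseteq> f ` E"
  show "D \<subseteq> E"
  proof
    fix t assume "t \<in> D"
    then obtain e where "e \<in> E" "f t = f e" using sub by blast
    then show "t \<in> E" using assms \<open>t \<in> D\<close> by (metis inj_onD subsetD)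
  qed
qed blast

lemma inj_on_set_encode_fam: "finite_fam F \<Longrightarrow> inj_on set_encode F"
  using inj_on_set_encode by (auto simp: finite_fam_def inj_on_def)

lemma encode_subset_iff:
  assumes "finite_fam F" "D \<subseteq> F" "E \<subseteq> F"
  shows "set_encode ` D \<subseteq> set_encode ` E \<longleftrightarrow> D \<subseteq> E"
  using inj_on_image_subset[OF inj_on_set_encode_fam[OF assms(1)] assms(2,3)] .

lemma finite_fam_down_fam: "finite_fam F \<Longrightarrow> finite_fam (down_fam F)"
  unfolding finite_fam_def down_fam_def downclosed_def
  by (auto intro: finite_subset finite_imageI)

lemma card_down_fam:
  assumes "finite_fam F" shows "card (down_fam F) = card {D. downclosed F D}"
  unfolding down_fam_def
proof (rule card_image, rule inj_onI)
  fix D E assume "D \<in> {D. downclosed F D}" "E \<in> {D. downclosed F D}"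
    "set_encode ` D = set_encode ` E"
  then show "D = E"
    using encode_subset_iff[OF assms, of D E] encode_subset_iff[OF assms, of E D]
    by (auto simp: downclosed_def)
qed

text \<open>The adjunction between the line digraph (passing from increasing \<open>k\<close>-tuples to
  \<open>(k+1)\<close>-tuples) and the poset of down-sets: a map \<open>f\<close> on \<open>(k+1)\<close>-tuples is turned into
  the down-sets generated by all \<open>f (x # ys)\<close>; conversely \<open>f zs\<close> is chosen in
  \<open>g (tl zs) - g (butlast zs)\<close>.\<close>

lemma fam_hom_down_fam:
  assumes F: "finite_fam F" and k: "k \<ge> 1"
  shows "(\<exists>f. fam_hom N (Suc k) F f) \<longleftrightarrow> (\<exists>g. fam_hom N k (down_fam F) g)"
proof
  assume "\<exists>f. fam_hom N (Suc k) F f"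
  then obtain f where fF: "\<And>xs. xs \<in> incr N (Suc k) \<Longrightarrow> f xs \<in> F"
    and f: "\<And>xs. xs \<in> incr N (Suc (Suc k)) \<Longrightarrow> \<not> f (tl xs) \<subseteq> f (butlast xs)"
    unfolding fam_hom_def by blast
  define D where "D ys = {Y\<in>F. \<exists>x. x # ys \<in> incr N (Suc k) \<and> Y \<subseteq> f (x # ys)}" for ys
  have dc: "downclosed F (D ys)" for ys
    unfolding downclosed_def D_def by blast
  have "fam_hom N k (down_fam F) (\<lambda>ys. set_encode ` D ys)"
    unfolding fam_hom_def
  proof (intro conjI ballI)
    fix xs show "set_encode ` D xs \<in> down_fam F"
      using dc unfolding down_fam_def by blast
  next
    fix zs assume zs: "zs \<in> incr N (Suc k)"
    then have "hd zs # tl zs = zs" by (cases zs) (auto simp: incr_def)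
    then have "f zs \<in> D (tl zs)" using zs fF[OF zs] unfolding D_def
      by (auto intro!: exI[of _ "hd zs"])
    moreover have "f zs \<notin> D (butlast zs)"
    proof
      assume "f zs \<in> D (butlast zs)"
      then obtain x where x: "x # butlast zs \<in> incr N (Suc k)" "f zs \<subseteq> f (x # butlast zs)"
        unfolding D_def by blast
      \<comment> \<open>The glued tuple \<open>x # zs\<close> has \<open>zs\<close> as its later and
        \<open>x # butlast zs\<close> as its earlier edge.\<close>
      from incr_Cons_glue[OF x(1) zs k] have "\<not> f zs \<subseteq> f (butlast (x # zs))"
        using f[of "x # zs"] by simp
      then show False using x zs by (auto simp: incr_def)
    qed
    ultimately show "\<not> set_encode ` D (tl zs) \<subseteq> set_encode ` D (butlast zs)"
      using encode_subset_iff[OF F, of "D (tl zs)" "D (butlast zs)"] dc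
      unfolding downclosed_def by blast
  qed
  then show "\<exists>g. fam_hom N k (down_fam F) g" by blast
next
  assume "\<exists>g. fam_hom N k (down_fam F) g"
  then obtain g where gF: "\<And>xs. xs \<in> incr N k \<Longrightarrow> g xs \<in> down_fam F"
    and g: "\<And>xs. xs \<in> incr N (Suc k) \<Longrightarrow> \<not> g (tl xs) \<subseteq> g (butlast xs)"
    unfolding fam_hom_def by blast
  have "\<exists>D. downclosed F D \<and> g xs = set_encode ` D" if "xs \<in> incr N k" for xs
    using gF[OF that] unfolding down_fam_def by blast
  then obtain D where D: "\<And>xs. xs \<in> incr N k \<Longrightarrow> downclosed F (D xs)"
    "\<And>xs. xs \<in> incr N k \<Longrightarrow> g xs = set_encode ` D xs" by metis
  have "\<exists>Y. Y \<in> D (tl xs) \<and> Y \<notin> D (butlast xs)" if "xs \<in> incr N (Suc k)" for xs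
    using g[OF that] D(2)[OF incr_tl[OF that]] D(2)[OF incr_butlast[OF that]] by auto
  then obtain f where f: "\<And>xs. xs \<in> incr N (Suc k) \<Longrightarrow> f xs \<in> D (tl xs)"
    "\<And>xs. xs \<in> incr N (Suc k) \<Longrightarrow> f xs \<notin> D (butlast xs)" by metis
  have fF: "f xs \<in> F" if "xs \<in> incr N (Suc k)" for xs
    using f(1)[OF that] D(1)[OF incr_tl[OF that]] by (auto simp: downclosed_def)
  have "fam_hom N (Suc k) F f"
    unfolding fam_hom_def
  proof (intro conjI ballI notI)
    fix xs assume "xs \<in> incr N (Suc k)" then show "f xs \<in> F" by (rule fF)
  next
    fix xs assume xs: "xs \<in> incr N (Suc (Suc k))" and le: "f (tl xs) \<subseteq> f (butlast xs)"
    \<comment> \<open>The overlap \<open>tl (butlast xs) = butlast (tl xs)\<close> of the two edges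
      has a down-set that contains \<open>f (butlast xs)\<close> but avoids
      \<open>f (tl xs)\<close>.\<close>
    have "f (butlast xs) \<in> D (tl (butlast xs))" using f(1) incr_butlast[OF xs] by blast
    moreover have "f (tl xs) \<notin> D (tl (butlast xs))"
      using f(2)[OF incr_tl[OF xs]] by (simp add: butlast_tl)
    moreover have "downclosed F (D (tl (butlast xs)))"
      using D(1) incr_butlast[OF xs] incr_tl by blast
    ultimately show False using fF[OF incr_tl[OF xs]] le unfolding downclosed_def by blast
  qed
  then show "\<exists>f. fam_hom N (Suc k) F f" by blast
qed

text \<open>On points \<open>x < y\<close> the condition forbids
  \<open>f [y] \<subseteq> f [x]\<close>, which makes \<open>f\<close> injective. Conversely,
  listing \<open>F\<close> by increasing cardinality is a linear extension of inclusion and gives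
  such a map.\<close>

lemma fam_hom_1_iff:
  assumes F: "finite_fam F"
  shows "(\<exists>f. fam_hom N 1 F f) \<longleftrightarrow> N \<le> card F"
proof
  assume "\<exists>f. fam_hom N 1 F f"
  then obtain f where fF: "\<And>xs. xs \<in> incr N 1 \<Longrightarrow> f xs \<in> F"
    and f: "\<And>xs. xs \<in> incr N (Suc 1) \<Longrightarrow> \<not> f (tl xs) \<subseteq> f (butlast xs)"
    unfolding fam_hom_def by blast
  have ne: "f [x] \<noteq> f [y]" if "x \<in> {1..N}" "y \<in> {1..N}" "x < y" for x y
    using f[of "[x, y]"] that by (auto simp: incr_def)
  have "inj_on (\<lambda>x. f [x]) {1..N}"
    using ne by (intro inj_onI) (metis linorder_neqE_nat)
  moreover have "(\<lambda>x. f [x]) ` {1..N} \<subseteq> F"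
    using fF by (auto simp: incr_def)
  ultimately show "N \<le> card F"
    using card_inj_on_le[of "\<lambda>x. f [x]" "{1..N}" F] F by (simp add: finite_fam_def)
next
  assume N: "N \<le> card F"
  obtain ys where ys: "set ys = F" "distinct ys"
    using F finite_distinct_list unfolding finite_fam_def by blast
  define zs where "zs = sort_key card ys"
  have zs: "set zs = F" "distinct zs" "sorted (map card zs)" "length zs = card F"
    using ys distinct_card[OF ys(2)] by (auto simp: zs_def)
  define f where "f xs = zs ! (hd xs - 1)" for xs
  have "fam_hom N 1 F f"
    unfolding fam_hom_def
  proof (intro conjI ballI)
    fix xs assume "xs \<in> incr N 1"
    then obtain x where "xs = [x]" "x \<in> {1..N}"
      by (cases xs) (auto simp: incr_def)
    then show "f xs \<in> F" using zs N nth_mem[of "x - 1" zs] by (auto simp: f_def)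
  next
    fix xs assume xs: "xs \<in> incr N (Suc 1)"
    then obtain x y where xy: "xs = [x, y]"
      by (auto simp: incr_def numeral_2_eq_2 length_Suc_conv)
    with xs have lt: "x - 1 < y - 1" "y - 1 < length zs" using N zs(4)
      by (auto simp: incr_def)
    show "\<not> f (tl xs) \<subseteq> f (butlast xs)"
    proof
      assume "f (tl xs) \<subseteq> f (butlast xs)"
      then have sub: "zs ! (y - 1) \<subseteq> zs ! (x - 1)" by (simp add: f_def xy)
      have "card (zs ! (x - 1)) \<le> card (zs ! (y - 1))"
        using sorted_nth_mono[OF zs(3), of "x - 1" "y - 1"] lt by simp
      moreover have "finite (zs ! (x - 1))"
        using zs(1) lt F nth_mem[of "x - 1" zs] by (auto simp: finite_fam_def)
      ultimately have "zs ! (y - 1) = zs ! (x - 1)"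
        using sub card_seteq by blast
      then show False using zs(2) lt by (simp add: nth_eq_iff_index_eq)
    qed
  qed
  then show "\<exists>f. fam_hom N 1 F f" by blast
qed

lemma finite_fam_iterate: "finite_fam F \<Longrightarrow> finite_fam ((down_fam ^^ j) F)"
  by (induction j) (auto simp: finite_fam_down_fam)

text \<open>Each use of \<open>fam_hom_down_fam\<close> trades one unit of uniformity for one
  \<open>down_fam\<close>, until \<open>fam_hom_1_iff\<close> applies.\<close>

lemma fam_hom_iff_card:
  assumes "finite_fam F"
  shows "(\<exists>f. fam_hom N (Suc j) F f) \<longleftrightarrow> N \<le> card ((down_fam ^^ j) F)"
  using assms
proof (induction j arbitrary: F)
  case 0
  then show ?case using fam_hom_1_iff by simp
next
  case (Suc j)
  then show ?case
    using fam_hom_down_fam[of F "Suc j" N] Suc.IH[OF finite_fam_down_fam[OF Suc.prems]]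
    by (simp add: funpow_swap1)
qed

section \<open>Colorings without monochromatic paths\<close>

definition seg :: "nat \<Rightarrow> nat \<Rightarrow> nat set" where
  "seg i l = (\<lambda>v. prod_encode (i, v)) ` {..<l}"

text \<open>Segments carry their color \<open>i\<close> as a tag. Length \<open>0\<close> is
  excluded because the empty segment would lie below every chain.\<close>

definition chain_fam :: "nat \<Rightarrow> nat \<Rightarrow> nat set set" where
  "chain_fam q m = {seg i l |i l. i \<in> {1..q} \<and> l \<in> {1..<m}}"

lemma seg_subset_iff: "l \<ge> 1 \<Longrightarrow> seg i l \<subseteq> seg i' l' \<longleftrightarrow> i = i' \<and> l \<le> l'"
proof
  assume "l \<ge> 1" and sub: "seg i l \<subseteq> seg i' l'"
  then have "prod_encode (i, l - 1) \<in> seg i' l'" by (auto simp: seg_def)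
  then show "i = i' \<and> l \<le> l'" by (auto simp: seg_def)
qed (auto simp: seg_def)

lemma seg_eq_iff: "l \<ge> 1 \<Longrightarrow> l' \<ge> 1 \<Longrightarrow> seg i l = seg i' l' \<longleftrightarrow> i = i' \<and> l = l'"
  using seg_subset_iff[of l i i' l'] seg_subset_iff[of l' i' i l] by fastforce

lemma finite_fam_chains: "finite_fam (chain_fam q m)"
proof -
  have "chain_fam q m = (\<lambda>(i, l). seg i l) ` ({1..q} \<times> {1..<m})"
    unfolding chain_fam_def image_def by fastforce
  then show ?thesis by (auto simp: finite_fam_def seg_def)
qed

text \<open>\<open>l\<close> counts edges: a path with \<open>l\<close> edges has
  \<open>l + k - 1\<close> vertices, and its edges are the windows of length
  \<open>k\<close>.\<close>

definition mono_list :: "nat \<Rightarrow> nat \<Rightarrow> (nat set \<Rightarrow> nat) \<Rightarrow> nat \<Rightarrow> nat \<Rightarrow> nat list \<Rightarrow> bool" where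
  "mono_list N k \<chi> a l p \<longleftrightarrow> p \<in> incr N (l + k - 1) \<and> (\<forall>i<l. \<chi> (set (take k (drop i p))) = a)"

lemma image_interval_eq_window:
  assumes "1 \<le> i" "i + k - 1 \<le> length p" "k \<ge> 1"
  shows "(\<lambda>i. p ! (i - 1)) ` {i..i + k - 1} = set (take k (drop (i - 1) p))"
proof -
  have "take k (drop (i - 1) p) = map (\<lambda>t. p ! (i - 1 + t)) [0..<k]"
    using assms by (intro nth_equalityI) auto
  then have "set (take k (drop (i - 1) p)) = (\<lambda>t. p ! (i - 1 + t)) ` {0..<k}" by simp
  also have "\<dots> = (\<lambda>i. p ! (i - 1)) ` (\<lambda>t. i + t) ` {0..<k}"
    unfolding image_image using assms by (intro image_cong) auto
  also have "(\<lambda>t. i + t) ` {0..<k} = {i..i + k - 1}"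
    using assms by (auto simp: image_iff intro!: bexI[of _ "_ - i"])
  finally show ?thesis by simp
qed

lemma mono_path_iff_mono_list:
  assumes "1 \<le> k" "k \<le> n"
  shows "(\<exists>j. monotone_path N n j \<and> (\<exists>a. \<forall>e \<in> path_edges k n j. \<chi> e = a)) \<longleftrightarrow>
    (\<exists>a p. mono_list N k \<chi> a (n - k + 1) p)" (is "?L \<longleftrightarrow> ?R")
proof
  assume ?L
  then obtain j a where j: "monotone_path N n j" and a: "\<And>e. e \<in> path_edges k n j \<Longrightarrow> \<chi> e = a"
    by blast
  define p where "p = map j [1..<Suc n]"
  have pn: "p ! (i - 1) = j i" if "i \<in> {1..n}" for i
    using that nth_map_upt[of "i - 1" "Suc n" 1 j] by (auto simp: p_def simp del: upt_Suc)
  have len: "length p = n" by (simp add: p_def)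
  have "sorted_wrt (<) p"
    using j by (auto simp: p_def sorted_wrt_iff_nth_less monotone_path_def strict_mono_on_def
      simp del: upt_Suc)
  then have "p \<in> incr N n"
    using j by (auto simp: incr_def p_def monotone_path_def simp del: upt_Suc)
  moreover have "\<chi> (set (take k (drop i p))) = a" if "i < n - k + 1" for i
  proof -
    have "(\<lambda>i. p ! (i - 1)) ` {Suc i..Suc i + k - 1} = j ` {Suc i..Suc i + k - 1}"
      using that assms by (intro image_cong refl pn) auto
    then have "set (take k (drop i p)) = j ` {Suc i..Suc i + k - 1}"
      using image_interval_eq_window[of "Suc i" k p] that assms len by auto
    moreover have "j ` {Suc i..Suc i + k - 1} \<in> path_edges k n j"
      using that unfolding path_edges_def by (intro imageI) auto
    ultimately show ?thesis using a by simp
  qed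
  ultimately show ?R using assms unfolding mono_list_def by (intro exI[of _ a] exI[of _ p]) auto
next
  assume ?R
  then obtain a p where p: "p \<in> incr N n" and
    a: "\<And>i. i < n - k + 1 \<Longrightarrow> \<chi> (set (take k (drop i p))) = a"
    using assms unfolding mono_list_def by auto
  define j where "j i = p ! (i - 1)" for i
  have len: "length p = n" using p by (simp add: incr_def)
  have "monotone_path N n j"
    unfolding monotone_path_def
  proof
    show "strict_mono_on {1..n} j"
      using p by (auto simp: incr_def j_def strict_mono_on_def sorted_wrt_iff_nth_less)
    show "j ` {1..n} \<subseteq> {1..N}"
    proof
      fix y assume "y \<in> j ` {1..n}"
      then have "y \<in> set p" using len by (auto simp: j_def)
      then show "y \<in> {1..N}" using p by (auto simp: incr_def)
    qed
  qed
  moreover have "\<chi> e = a" if e: "e \<in> path_edges k n j" for e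
  proof -
    obtain i where i: "i \<in> {1..n - k + 1}" "e = j ` {i..i + k - 1}"
      using e unfolding path_edges_def by blast
    have "1 \<le> i" "i + k - 1 \<le> length p" using i(1) assms len by auto
    from image_interval_eq_window[OF this assms(1)]
    have "e = set (take k (drop (i - 1) p))" unfolding i(2) j_def .
    then show ?thesis using a[of "i - 1"] i by auto
  qed
  ultimately show ?L by blast
qed

text \<open>The last edge of \<open>p\<close> starts at position \<open>l - 1\<close>. If it is
  \<open>butlast xs\<close>, then \<open>last p\<close> is the last but one entry of
  \<open>xs\<close>, so \<open>last xs\<close> exceeds all of \<open>p\<close> and can be appended;
  the only new window is \<open>tl xs\<close>.\<close>

lemma mono_list_extend:
  assumes p: "mono_list N k \<chi> a l p" "l \<ge> 1" "k \<ge> 1"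
    and xs: "xs \<in> incr N (Suc k)" "drop (l - 1) p = butlast xs" "\<chi> (set (tl xs)) = a"
  shows "mono_list N k \<chi> a (Suc l) (p @ [last xs])" "drop l (p @ [last xs]) = tl xs"
proof -
  have len: "length p = l + k - 1" using p by (simp add: mono_list_def incr_def)
  have ne: "xs \<noteq> []" "butlast xs \<noteq> []" using xs(1) \<open>k \<ge> 1\<close>
    by (auto simp: incr_def simp flip: length_0_conv)
  have "drop (l - 1) (p @ [last xs]) = xs" using xs(2) len ne p(3) by simp
  then have "tl (drop (l - 1) (p @ [last xs])) = tl xs" by simp
  then show dr: "drop l (p @ [last xs]) = tl xs"
    using p(2) by (metis One_nat_def Suc_pred' drop_Suc less_eq_Suc_le tl_drop)
  have lastp: "last p = last (butlast xs)"
    using xs(2) ne by (metis drop_eq_Nil last_drop linorder_not_le)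
  have "sorted_wrt (<) (butlast xs @ [last xs])"
    using xs(1) ne by (simp add: incr_def)
  then have less: "last p < last xs"
    unfolding sorted_wrt_append using lastp ne by simp
  have sp: "sorted_wrt (<) p" using p by (simp add: mono_list_def incr_def)
  have "y < last xs" if "y \<in> set p" for y
  proof -
    have "p \<noteq> []" using that by auto
    then have "sorted_wrt (<) (butlast p @ [last p])" "y \<in> set (butlast p @ [last p])"
      using sp that by auto
    then have "y \<le> last p" by (auto simp: sorted_wrt_append)
    then show ?thesis using less by simp
  qed
  moreover have "last xs \<in> {1..N}" using xs(1) last_in_set[OF ne(1)] by (auto simp: incr_def)
  ultimately have inc: "p @ [last xs] \<in> incr N (Suc l + k - 1)"
    using p by (auto simp: mono_list_def incr_def sorted_wrt_append)
  have "\<chi> (set (take k (drop i (p @ [last xs])))) = a" if "i < Suc l" for i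
  proof (cases "i = l")
    case True
    have "length (tl xs) = k" using xs(1) by (simp add: incr_def)
    then show ?thesis using True dr xs(3) by simp
  next
    case False
    then have "take k (drop i (p @ [last xs])) = take k (drop i p)"
      using that len by simp
    then show ?thesis using p(1) False that by (simp add: mono_list_def del: take_append drop_append)
  qed
  then show "mono_list N k \<chi> a (Suc l) (p @ [last xs])"
    using inc by (simp add: mono_list_def)
qed

text \<open>The chain of \<open>f xs\<close> serves as the color of \<open>xs\<close>, and the
  position in it rises along a monochromatic path, which bounds the number of edges. Conversely, the
  position is the largest number of edges of a monochromatic path ending in
  \<open>xs\<close>.\<close>

lemma fam_hom_chains_iff:
  assumes k: "1 \<le> k" "k < n"
  shows "(\<exists>f. fam_hom N k (chain_fam q (n - k + 1)) f) \<longleftrightarrow> \<not> forces_mono_path k q n N"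
proof -
  define m where "m = n - k + 1"
  have m: "m \<ge> 2" using k by (simp add: m_def)
  have forces: "forces_mono_path k q n N \<longleftrightarrow>
    (\<forall>\<chi> \<in> [{1..N}]\<^bsup>k\<^esup> \<rightarrow> {1..q}. \<exists>a p. mono_list N k \<chi> a m p)"
    unfolding forces_mono_path_def m_def using mono_path_iff_mono_list k by simp
  show ?thesis
    unfolding m_def[symmetric] forces
  proof
    assume "\<exists>f. fam_hom N k (chain_fam q m) f"
    then obtain f where fF: "\<And>xs. xs \<in> incr N k \<Longrightarrow> f xs \<in> chain_fam q m"
      and f: "\<And>xs. xs \<in> incr N (Suc k) \<Longrightarrow> \<not> f (tl xs) \<subseteq> f (butlast xs)"
      unfolding fam_hom_def by blast
    have "\<exists>i l. i \<in> {1..q} \<and> l \<in> {1..<m} \<and> f xs = seg i l" if "xs \<in> incr N k" for xs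
      using fF[OF that] unfolding chain_fam_def by blast
    then obtain c L where c: "\<And>xs. xs \<in> incr N k \<Longrightarrow> c xs \<in> {1..q}"
      and L: "\<And>xs. xs \<in> incr N k \<Longrightarrow> L xs \<in> {1..<m}"
      and fs: "\<And>xs. xs \<in> incr N k \<Longrightarrow> f xs = seg (c xs) (L xs)" by metis
    define \<chi> where "\<chi> e = c (sorted_list_of_set e)" for e
    have "\<chi> \<in> [{1..N}]\<^bsup>k\<^esup> \<rightarrow> {1..q}"
    proof
      fix e assume "e \<in> [{1..N}]\<^bsup>k\<^esup>"
      then have "sorted_list_of_set e \<in> incr N k"
        by (auto simp: nsets_def incr_def)
      then show "\<chi> e \<in> {1..q}" using c by (simp add: \<chi>_def)
    qed
    moreover have "\<not> mono_list N k \<chi> a m p" for a p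
    proof
      assume ml: "mono_list N k \<chi> a m p"
      define W where "W t = take k (drop t p)" for t
      have p: "p \<in> incr N (m + k - 1)" using ml by (simp add: mono_list_def)
      have W: "W t \<in> incr N k" if "t < m" for t
        unfolding W_def using that by (intro incr_take[OF incr_drop[OF p]]) auto
      have cW: "c (W t) = a" if "t < m" for t
      proof -
        have "\<chi> (set (W t)) = a" using ml that by (simp add: mono_list_def W_def)
        then show ?thesis by (simp add: \<chi>_def sorted_list_of_set_incr[OF W[OF that]])
      qed
      have step: "L (W t) < L (W (Suc t))" if "Suc t < m" for t
      proof -
        let ?x = "take (Suc k) (drop t p)"
        have x: "?x \<in> incr N (Suc k)"
          using that by (intro incr_take[OF incr_drop[OF p]]) auto
        have "tl ?x = W (Suc t)"
          unfolding W_def by (simp add: tl_take tl_drop drop_Suc)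
        moreover have "butlast ?x = W t"
          using p that unfolding W_def by (simp add: butlast_take incr_def)
        ultimately have "\<not> f (W (Suc t)) \<subseteq> f (W t)" using f[OF x] by simp
        then have "\<not> seg a (L (W (Suc t))) \<subseteq> seg a (L (W t))"
          using fs[OF W] cW that by simp
        then show ?thesis using L[OF W[OF that]] by (simp add: seg_subset_iff)
      qed
      \<comment> \<open>At \<open>t = m - 1\<close> this forces a position of at least
        \<open>m\<close>, while positions stay below \<open>m\<close>.\<close>
      have "t < m \<Longrightarrow> t < L (W t)" for t
      proof (induction t)
        case 0
        then show ?case using L[OF W] by force
      next
        case (Suc t)
        then show ?case using step[of t] by simp
      qed
      from this[of "m - 1"] L[OF W, of "m - 1"] m show False by simp
    qed
    ultimately show "\<not> (\<forall>\<chi> \<in> [{1..N}]\<^bsup>k\<^esup> \<rightarrow> {1..q}. \<exists>a p. mono_list N k \<chi> a m p)" by blast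
  next
    assume "\<not> (\<forall>\<chi> \<in> [{1..N}]\<^bsup>k\<^esup> \<rightarrow> {1..q}. \<exists>a p. mono_list N k \<chi> a m p)"
    then obtain \<chi> where \<chi>: "\<chi> \<in> [{1..N}]\<^bsup>k\<^esup> \<rightarrow> {1..q}"
      and no: "\<And>a p. \<not> mono_list N k \<chi> a m p" by blast
    \<comment> \<open>\<open>drop (l - 1) p = xs\<close> says that \<open>xs\<close> is the last
      edge of \<open>p\<close>.\<close>
    define A where "A xs = {l\<in>{1..<m}. \<exists>p. mono_list N k \<chi> (\<chi> (set xs)) l p \<and> drop (l - 1) p = xs}" for xs
    define L where "L xs = Max (A xs)" for xs
    have finA: "finite (A xs)" for xs unfolding A_def by simp
    have LA: "L xs \<in> A xs" if "xs \<in> incr N k" for xs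
    proof -
      have "1 \<in> A xs" using that m by (auto simp: A_def mono_list_def incr_def)
      then show ?thesis unfolding L_def using finA Max_in by blast
    qed
    have "fam_hom N k (chain_fam q m) (\<lambda>xs. seg (\<chi> (set xs)) (L xs))"
      unfolding fam_hom_def
    proof (intro conjI ballI)
      fix xs assume xs: "xs \<in> incr N k"
      have "\<chi> (set xs) \<in> {1..q}" using \<chi> set_incr_nsets[OF xs] by blast
      moreover have "L xs \<in> {1..<m}" using LA[OF xs] by (auto simp: A_def)
      ultimately show "seg (\<chi> (set xs)) (L xs) \<in> chain_fam q m" unfolding chain_fam_def by blast
    next
      fix xs assume xs: "xs \<in> incr N (Suc k)"
      let ?u = "butlast xs" and ?v = "tl xs"
      have u: "L ?u \<in> A ?u" and v: "L ?v \<in> A ?v"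
        using LA incr_butlast[OF xs] incr_tl[OF xs] by auto
      have Lv: "L ?v \<ge> 1" using v by (simp add: A_def)
      show "\<not> seg (\<chi> (set ?v)) (L ?v) \<subseteq> seg (\<chi> (set ?u)) (L ?u)"
      proof
        assume "seg (\<chi> (set ?v)) (L ?v) \<subseteq> seg (\<chi> (set ?u)) (L ?u)"
        then have eq: "\<chi> (set ?v) = \<chi> (set ?u)" and le: "L ?v \<le> L ?u"
          using seg_subset_iff[OF Lv] by auto
        obtain p where p: "mono_list N k \<chi> (\<chi> (set ?u)) (L ?u) p" "drop (L ?u - 1) p = ?u"
          and Lu: "L ?u \<ge> 1" "L ?u < m"
          using u by (auto simp: A_def)
        note ext = mono_list_extend[OF p(1) Lu(1) k(1) xs p(2) eq]
        \<comment> \<open>No monochromatic path has \<open>m\<close> edges, so the extended path is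
          still counted in \<open>A ?v\<close>.\<close>
        have "Suc (L ?u) \<noteq> m" using ext(1) no by metis
        then have "Suc (L ?u) \<in> A ?v" using ext eq Lu by (auto simp: A_def)
        then have "Suc (L ?u) \<le> L ?v" unfolding L_def[of ?v] using finA by simp
        then show False using le by simp
      qed
    qed
    then show "\<exists>f. fam_hom N k (chain_fam q m) f" by blast
  qed
qed

text \<open>Colorings without a monochromatic path exist exactly for \<open>N\<close> up to this
  cardinality.\<close>

theorem mono_path_number_eq:
  assumes "1 \<le> k" "k < n"
  shows "mono_path_number k q n = card ((down_fam ^^ (k - 1)) (chain_fam q (n - k + 1))) + 1"
proof -
  have iff: "forces_mono_path k q n N \<longleftrightarrow> card ((down_fam ^^ (k - 1)) (chain_fam q (n - k + 1))) < N" for N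
    using fam_hom_chains_iff[OF assms, of N q]
      fam_hom_iff_card[OF finite_fam_chains, of N "k - 1" q "n - k + 1"] assms by auto
  show ?thesis unfolding mono_path_number_def iff
    by (rule Least_equality) auto
qed

section \<open>Size and width of the iterated families of down-sets\<close>

lemma card_down_fam_le:
  assumes "finite_fam F" shows "card (down_fam F) \<le> 2 ^ card F"
proof -
  have "card {D. downclosed F D} \<le> card (Pow F)"
    using assms by (intro card_mono) (auto simp: finite_fam_def downclosed_def)
  then show ?thesis using assms by (simp add: card_down_fam card_Pow finite_fam_def)
qed

text \<open>A down-set meets a chain in an initial segment, and two initial segments of a chain are
  nested, hence determined by their size.\<close>

lemma downclosed_inter_chain_eq:
  assumes D: "downclosed F D" "downclosed F E" and C: "C \<subseteq> F" "finite C"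
    and chain: "\<And>X Y. X \<in> C \<Longrightarrow> Y \<in> C \<Longrightarrow> X \<subseteq> Y \<or> Y \<subseteq> X"
    and card: "card (D \<inter> C) = card (E \<inter> C)"
  shows "D \<inter> C = E \<inter> C"
proof -
  have "D \<inter> C \<subseteq> E \<inter> C \<or> E \<inter> C \<subseteq> D \<inter> C"
  proof (rule ccontr)
    assume "\<not> ?thesis"
    then obtain X Y where "X \<in> D" "X \<in> C" "X \<notin> E" "Y \<in> E" "Y \<in> C" "Y \<notin> D" by blast
    with chain[of X Y] D C(1) show False unfolding downclosed_def by blast
  qed
  then show ?thesis using card C(2) by (metis card_subset_eq finite_Int)
qed

text \<open>A down-set is determined by the sizes of its intersections with the covering chains, and
  each size is one of \<open>0, ..., s\<close>.\<close>

lemma card_down_fam_chain_cover: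
  assumes F: "finite_fam F" and I: "finite I"
    and cover: "F = (\<Union>i\<in>I. C i)"
    and chain: "\<And>i X Y. i \<in> I \<Longrightarrow> X \<in> C i \<Longrightarrow> Y \<in> C i \<Longrightarrow> X \<subseteq> Y \<or> Y \<subseteq> X"
    and card: "\<And>i. i \<in> I \<Longrightarrow> card (C i) \<le> s"
  shows "card (down_fam F) \<le> (s + 1) ^ card I"
proof -
  define h where "h D = (\<lambda>i\<in>I. card (D \<inter> C i))" for D
  have finC: "finite (C i)" if "i \<in> I" for i
    using F that cover finite_subset[of "C i" F] by (auto simp: finite_fam_def)
  have "inj_on h {D. downclosed F D}"
  proof (rule inj_onI)
    fix D E assume DE: "D \<in> {D. downclosed F D}" "E \<in> {D. downclosed F D}" "h D = h E"
    have "D \<inter> C i = E \<inter> C i" if i: "i \<in> I" for i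
    proof (rule downclosed_inter_chain_eq)
      show "downclosed F D" "downclosed F E" using DE by auto
      show "C i \<subseteq> F" using cover i by blast
      show "card (D \<inter> C i) = card (E \<inter> C i)"
        using fun_cong[OF DE(3), of i] i by (simp add: h_def)
    qed (use finC chain i in auto)
    then have "D \<inter> F = E \<inter> F" unfolding cover by blast
    then show "D = E" using DE(1,2) by (auto simp: downclosed_def)
  qed
  moreover have "h ` {D. downclosed F D} \<subseteq> I \<rightarrow>\<^sub>E {..s}"
  proof -
    have "card (D \<inter> C i) \<le> s" if "i \<in> I" for D i
      using card_mono[OF finC[OF that], of "D \<inter> C i"] card[OF that] by simp
    then show ?thesis by (auto simp: h_def)
  qed
  ultimately have "card {D. downclosed F D} \<le> card (I \<rightarrow>\<^sub>E {..s})"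
    by (intro card_inj_on_le) (auto simp: finite_PiE I)
  also have "\<dots> = (s + 1) ^ card I" using I by (simp add: card_PiE)
  finally show ?thesis using card_down_fam[OF F] by simp
qed

section \<open>The first iterate as a grid\<close>

text \<open>The grid point \<open>x\<close>, encoded as the down-set that consists of the lowest
  \<open>x i\<close> members of each chain \<open>i\<close>.\<close>

definition stair :: "nat \<Rightarrow> (nat \<Rightarrow> nat) \<Rightarrow> nat set" where
  "stair q x = set_encode ` {seg i l |i l. i \<in> {1..q} \<and> l \<in> {1..x i}}"

lemma stair_subset_iff: "stair q x \<subseteq> stair q y \<longleftrightarrow> (\<forall>i\<in>{1..q}. x i \<le> y i)"
proof -
  let ?S = "\<lambda>x. {seg i l |i l. i \<in> {1..q} \<and> l \<in> {1..x i}}"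
  have fin: "finite X" if "X \<in> ?S x" for X x using that by (auto simp: seg_def)
  have "stair q x \<subseteq> stair q y \<longleftrightarrow> ?S x \<subseteq> ?S y"
    unfolding stair_def
    by (rule inj_on_image_subset[OF inj_on_set_encode]) (use fin in blast)+
  also have "\<dots> \<longleftrightarrow> (\<forall>i\<in>{1..q}. x i \<le> y i)"
  proof
    assume sub: "?S x \<subseteq> ?S y"
    show "\<forall>i\<in>{1..q}. x i \<le> y i"
    proof
      fix i assume i: "i \<in> {1..q}"
      show "x i \<le> y i"
      proof (cases "x i = 0")
        case False
        then have "seg i (x i) \<in> ?S x" using i by force
        then obtain i' l where "seg i (x i) = seg i' l" "l \<in> {1..y i'}" using sub by blast
        then show ?thesis using False seg_eq_iff[of "x i" l i i'] by auto
      qed simp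
    qed
  next
    assume "\<forall>i\<in>{1..q}. x i \<le> y i"
    then show "?S x \<subseteq> ?S y" by fastforce
  qed
  finally show ?thesis .
qed

text \<open>A down-set meets chain \<open>i\<close> in an initial segment; its length, between
  \<open>0\<close> and \<open>m - 1\<close>, is the coordinate \<open>x i\<close>.\<close>

lemma down_fam_chains:
  assumes "m \<ge> 1"
  shows "down_fam (chain_fam q m) = stair q ` ({1..q} \<rightarrow>\<^sub>E {..<m})"
proof (intro equalityI subsetI)
  fix Z assume "Z \<in> down_fam (chain_fam q m)"
  then obtain D where D: "downclosed (chain_fam q m) D" and Z: "Z = set_encode ` D"
    unfolding down_fam_def by blast
  define x where "x = (\<lambda>i\<in>{1..q}. LEAST l. seg i (Suc l) \<notin> D)"
  \<comment> \<open>The chains stop at length \<open>m - 1\<close>, so the minimum defining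
    \<open>x i\<close> is attained and at most \<open>m - 1\<close>.\<close>
  have last: "seg i (Suc (m - 1)) \<notin> D" for i
  proof
    assume "seg i (Suc (m - 1)) \<in> D"
    then obtain i' l where "seg i (Suc (m - 1)) = seg i' l" "l \<in> {1..<m}"
      using D unfolding downclosed_def chain_fam_def by blast
    then show False using seg_eq_iff[of "Suc (m - 1)" l i i'] by auto
  qed
  have x: "seg i (Suc (x i)) \<notin> D" "x i \<le> m - 1" if "i \<in> {1..q}" for i
    using LeastI[of "\<lambda>l. seg i (Suc l) \<notin> D", OF last]
      Least_le[of "\<lambda>l. seg i (Suc l) \<notin> D", OF last] that by (auto simp: x_def)
  have mem: "seg i l \<in> D \<longleftrightarrow> l \<le> x i" if i: "i \<in> {1..q}" and l: "l \<ge> 1" for i l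
  proof
    assume "seg i l \<in> D"
    show "l \<le> x i"
    proof (rule ccontr)
      assume "\<not> l \<le> x i"
      then have le: "seg i (Suc (x i)) \<subseteq> seg i l" by (simp add: seg_subset_iff)
      obtain i' l' where "seg i l = seg i' l'" "l' \<in> {1..<m}"
        using \<open>seg i l \<in> D\<close> D unfolding downclosed_def chain_fam_def by blast
      then have "l < m" using seg_eq_iff[of l l' i i'] l by auto
      then have "Suc (x i) < m" using \<open>\<not> l \<le> x i\<close> by simp
      then have "seg i (Suc (x i)) \<in> chain_fam q m" using i unfolding chain_fam_def by force
      then show False using D le \<open>seg i l \<in> D\<close> x(1)[OF i] unfolding downclosed_def by blast
    qed
  next
    assume "l \<le> x i"
    then have "l - 1 < (LEAST l. seg i (Suc l) \<notin> D)" using i l by (simp add: x_def)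
    from not_less_Least[OF this] show "seg i l \<in> D" using l by simp
  qed
  have "D = {seg i l |i l. i \<in> {1..q} \<and> l \<in> {1..x i}}"
  proof (intro equalityI subsetI)
    fix X assume "X \<in> D"
    moreover then obtain i l where "X = seg i l" "i \<in> {1..q}" "l \<in> {1..<m}"
      using D unfolding downclosed_def chain_fam_def by blast
    ultimately show "X \<in> {seg i l |i l. i \<in> {1..q} \<and> l \<in> {1..x i}}" using mem by fastforce
  qed (use mem in auto)
  then have "Z = stair q x" by (simp add: Z stair_def)
  moreover have "x \<in> {1..q} \<rightarrow>\<^sub>E {..<m}"
  proof (rule PiE_I)
    fix i assume "i \<in> {1..q}" then show "x i \<in> {..<m}" using x(2)[of i] assms by simp
  next
    fix i assume "i \<notin> {1..q}" then show "x i = undefined" unfolding x_def by (meson restrict_apply)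
  qed
  ultimately show "Z \<in> stair q ` ({1..q} \<rightarrow>\<^sub>E {..<m})" by blast
next
  fix Z assume "Z \<in> stair q ` ({1..q} \<rightarrow>\<^sub>E {..<m})"
  then obtain x where x: "x \<in> {1..q} \<rightarrow>\<^sub>E {..<m}" and Z: "Z = stair q x" by blast
  have lt: "x i < m" if "i \<in> {1..q}" for i using x that by (auto dest: PiE_mem)
  have "downclosed (chain_fam q m) {seg i l |i l. i \<in> {1..q} \<and> l \<in> {1..x i}}"
    unfolding downclosed_def
  proof (intro conjI ballI impI)
    show "{seg i l |i l. i \<in> {1..q} \<and> l \<in> {1..x i}} \<subseteq> chain_fam q m"
      using lt unfolding chain_fam_def by fastforce
  next
    fix X Y assume "X \<in> {seg i l |i l. i \<in> {1..q} \<and> l \<in> {1..x i}}" "Y \<in> chain_fam q m" and sub: "Y \<subseteq> X"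
    then obtain i l i' l' where *: "X = seg i l" "i \<in> {1..q}" "l \<in> {1..x i}"
      "Y = seg i' l'" "i' \<in> {1..q}" "l' \<in> {1..<m}" unfolding chain_fam_def by blast
    then have "i' = i \<and> l' \<le> l" using sub seg_subset_iff[of l' i' i l] by simp
    then show "Y \<in> {seg i l |i l. i \<in> {1..q} \<and> l \<in> {1..x i}}" using * by fastforce
  qed
  then show "Z \<in> down_fam (chain_fam q m)" unfolding Z stair_def down_fam_def by blast
qed

text \<open>Splits off the last coordinate, which runs freely along a chain in the upper bound and
  is fixed by the others in the antichain.\<close>

lemma PiE_atLeastAtMost_split:
  fixes q m :: nat
  assumes "q \<ge> 1"
  shows "{1..q} \<rightarrow>\<^sub>E {..<m} = {y(q := v) |y v. y \<in> {1..<q} \<rightarrow>\<^sub>E {..<m} \<and> v < m}"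
proof -
  have "{1..q} = insert q {1..<q}" using assms by auto
  then show ?thesis by (auto simp: PiE_insert_eq)
qed

lemma card_down_fam_2_chains_le:
  assumes "m \<ge> 1" "q \<ge> 1"
  shows "card (down_fam (down_fam (chain_fam q m))) \<le> (m + 1) ^ (m ^ (q - 1))"
proof -
  define I where "I = {1..<q} \<rightarrow>\<^sub>E {..<m}"
  define C where "C y = (\<lambda>v. stair q (y(q := v))) ` {..<m}" for y
  have "card (down_fam (down_fam (chain_fam q m))) \<le> (m + 1) ^ card I"
  proof (rule card_down_fam_chain_cover)
    show "finite_fam (down_fam (chain_fam q m))"
      by (intro finite_fam_down_fam finite_fam_chains)
    show "finite I" by (simp add: I_def finite_PiE)
    show "down_fam (chain_fam q m) = (\<Union>y\<in>I. C y)"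
      unfolding down_fam_chains[OF assms(1)] PiE_atLeastAtMost_split[OF assms(2)] I_def C_def
      by blast
    show "X \<subseteq> Y \<or> Y \<subseteq> X" if XY: "X \<in> C y" "Y \<in> C y" for y X Y
    proof -
      obtain v where X: "X = stair q (y(q := v))" using XY(1) by (auto simp: C_def)
      obtain w where Y: "Y = stair q (y(q := w))" using XY(2) by (auto simp: C_def)
      show ?thesis unfolding X Y by (cases "v \<le> w") (auto simp: stair_subset_iff)
    qed
    show "card (C y) \<le> m" for y
      unfolding C_def using card_image_le[of "{..<m}"] by fastforce
  qed
  also have "card I = m ^ (q - 1)" by (simp add: I_def card_PiE)
  finally show ?thesis .
qed

section \<open>Antichains and lower bounds\<close>

definition antichain :: "nat set set \<Rightarrow> bool" where
  "antichain A \<longleftrightarrow> (\<forall>X\<in>A. \<forall>Y\<in>A. X \<subseteq> Y \<longrightarrow> X = Y)"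

text \<open>Grid points with equal coordinate sum form an antichain. The first \<open>q - 1\<close>
  coordinates are classified by the quotient of their sum by \<open>m\<close>; one of the
  \<open>q - 1\<close> classes has at least the average size, and the last coordinate brings all its
  members to a common sum.\<close>

lemma width_down_fam_chains:
  assumes m: "m \<ge> 1" and q: "q \<ge> 2"
  shows "\<exists>A \<subseteq> down_fam (chain_fam q m). antichain A \<and> m ^ (q - 1) \<le> (q - 1) * card A"
proof -
  define I where "I = {1..<q} \<rightarrow>\<^sub>E {..<m}"
  define s where "s y = (\<Sum>i\<in>{1..<q}. y i)" for y :: "nat \<Rightarrow> nat"
  define K where "K r = {y\<in>I. s y div m = r}" for r
  have finI: "finite I" by (simp add: I_def finite_PiE)
  have s: "s y div m < q - 1" if "y \<in> I" for y
  proof -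
    \<comment> \<open>The sum is at most \<open>(q - 1) * (m - 1)\<close>, so its quotient by
      \<open>m\<close> is below \<open>q - 1\<close>.\<close>
    have "s y \<le> (\<Sum>i\<in>{1..<q}. m - 1)" unfolding s_def
      using that by (intro sum_mono) (auto simp: I_def dest!: PiE_mem)
    also have "\<dots> < (q - 1) * m" using m q by simp
    finally show ?thesis using m by (simp add: less_mult_imp_div_less)
  qed
  have "I = (\<Union>r<q - 1. K r)" using s by (auto simp: K_def)
  then have "card I \<le> (\<Sum>r<q - 1. card (K r))" using card_UN_le[of "{..<q - 1}" K] by simp
  moreover have "card I = m ^ (q - 1)" by (simp add: I_def card_PiE)
  ultimately have sumK: "m ^ (q - 1) \<le> (\<Sum>r<q - 1. card (K r))" by simp
  have "\<exists>r. m ^ (q - 1) \<le> (q - 1) * card (K r)"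
  proof (rule ccontr)
    assume "\<nexists>r. m ^ (q - 1) \<le> (q - 1) * card (K r)"
    then have "(q - 1) * card (K r) < m ^ (q - 1)" for r by (simp add: not_le)
    then have "(\<Sum>r<q - 1. (q - 1) * card (K r)) < (\<Sum>r<q - 1. m ^ (q - 1))"
      using q by (intro sum_strict_mono) (auto simp: lessThan_empty_iff)
    then have "(q - 1) * (\<Sum>r<q - 1. card (K r)) < (q - 1) * m ^ (q - 1)"
      by (simp add: sum_distrib_left)
    then show False using sumK by simp
  qed
  then obtain r where r: "m ^ (q - 1) \<le> (q - 1) * card (K r)" by blast
  \<comment> \<open>The last coordinate completes every \<open>y\<close> in \<open>K r\<close> to coordinate sum \<open>r * m + m - 1\<close>.\<close>
  define e where "e y = y(q := m - 1 - s y mod m)" for y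
  have sum_e: "(\<Sum>i\<in>{1..q}. e y i) = r * m + (m - 1)" if "y \<in> K r" for y
  proof -
    have "{1..q} = insert q {1..<q}" using q by auto
    then have "(\<Sum>i\<in>{1..q}. e y i) = e y q + (\<Sum>i\<in>{1..<q}. e y i)" by simp
    also have "(\<Sum>i\<in>{1..<q}. e y i) = s y" unfolding s_def e_def by (intro sum.cong) auto
    also have "s y = r * m + s y mod m" using that by (auto simp: K_def)
    finally have "(\<Sum>i\<in>{1..q}. e y i) = (m - 1 - s y mod m) + (r * m + s y mod m)"
      by (simp add: e_def)
    moreover have "s y mod m \<le> m - 1" using mod_less_divisor[of m "s y"] m by linarith
    ultimately show ?thesis by linarith
  qed
  have eq: "y = z" if y: "y \<in> K r" and z: "z \<in> K r" and sub: "stair q (e y) \<subseteq> stair q (e z)" for y z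
  proof -
    have le: "e y i \<le> e z i" if "i \<in> {1..q}" for i
      using sub that by (simp add: stair_subset_iff)
    have "e y i = e z i" if i: "i \<in> {1..q}" for i
    proof (rule ccontr)
      assume "e y i \<noteq> e z i"
      then have "(\<Sum>i\<in>{1..q}. e y i) < (\<Sum>i\<in>{1..q}. e z i)"
        using le i by (intro sum_strict_mono_ex1) (auto simp: le_neq_implies_less intro!: bexI[of _ i])
      then show False using sum_e y z by simp
    qed
    then have "y i = z i" if "i \<in> {1..<q}" for i
      using that by (force simp: e_def split: if_splits)
    moreover have "y \<in> I" "z \<in> I" using y z by (auto simp: K_def)
    ultimately show ?thesis unfolding I_def by (meson PiE_ext)
  qed
  let ?A = "(\<lambda>y. stair q (e y)) ` K r"
  have "?A \<subseteq> down_fam (chain_fam q m)"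
  proof -
    have "e y \<in> {1..q} \<rightarrow>\<^sub>E {..<m}" if "y \<in> K r" for y
    proof -
      have "y \<in> {1..<q} \<rightarrow>\<^sub>E {..<m}" using that by (auto simp: K_def I_def)
      moreover have "m - 1 - s y mod m < m" "q \<ge> 1" using m q by auto
      ultimately show ?thesis using PiE_atLeastAtMost_split[of q m] unfolding e_def by blast
    qed
    then show ?thesis unfolding down_fam_chains[OF m] by blast
  qed
  moreover have "antichain ?A" unfolding antichain_def using eq by blast
  moreover have "card ?A = card (K r)" using eq by (intro card_image inj_onI) blast
  ultimately show ?thesis using r by (intro exI[of _ ?A]) simp
qed

text \<open>\<open>h B\<close> is the down-set generated by \<open>B\<close>. A member of
  \<open>A\<close> lying in \<open>h B'\<close> is below some member of \<open>B'\<close> and, by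
  the antichain property, equal to it.\<close>

lemma antichain_embed_Pow:
  assumes F: "finite_fam F" and A: "A \<subseteq> F" "antichain A"
  obtains h where "h ` Pow A \<subseteq> down_fam F"
    "\<And>B B'. B \<subseteq> A \<Longrightarrow> B' \<subseteq> A \<Longrightarrow> h B \<subseteq> h B' \<Longrightarrow> B \<subseteq> B'"
proof
  define D where "D B = {Y\<in>F. \<exists>X\<in>B. Y \<subseteq> X}" for B
  have dc: "downclosed F (D B)" for B unfolding downclosed_def D_def by blast
  show "(\<lambda>B. set_encode ` D B) ` Pow A \<subseteq> down_fam F"
    using dc unfolding down_fam_def by blast
  fix B B' assume B: "B \<subseteq> A" "B' \<subseteq> A" "set_encode ` D B \<subseteq> set_encode ` D B'"
  then have sub: "D B \<subseteq> D B'"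
    using encode_subset_iff[OF F, of "D B" "D B'"] dc unfolding downclosed_def by blast
  show "B \<subseteq> B'"
  proof
    fix X assume X: "X \<in> B"
    then have "X \<in> D B'" using sub A(1) B(1) unfolding D_def by blast
    then obtain Y where "Y \<in> B'" "X \<subseteq> Y" unfolding D_def by blast
    then show "X \<in> B'" using A(2) X B unfolding antichain_def by blast
  qed
qed

lemma card_down_fam_ge:
  assumes F: "finite_fam F" and A: "A \<subseteq> F" "antichain A"
  shows "2 ^ card A \<le> card (down_fam F)"
proof -
  obtain h where h: "h ` Pow A \<subseteq> down_fam F"
    "\<And>B B'. B \<subseteq> A \<Longrightarrow> B' \<subseteq> A \<Longrightarrow> h B \<subseteq> h B' \<Longrightarrow> B \<subseteq> B'"
    using antichain_embed_Pow[OF assms] by metis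
  have "inj_on h (Pow A)"
    using h(2) by (intro inj_onI) (metis PowD subset_antisym subset_refl)
  then have "card (Pow A) \<le> card (down_fam F)"
    using h(1) finite_fam_down_fam[OF F] by (intro card_inj_on_le) (auto simp: finite_fam_def)
  moreover have "finite A" using A F finite_subset by (auto simp: finite_fam_def)
  ultimately show ?thesis by (simp add: card_Pow)
qed

text \<open>Subsets of \<open>A\<close> of one fixed size are pairwise incomparable, and so are
  their images under the embedding of \<open>Pow A\<close>.\<close>

lemma width_down_fam:
  assumes F: "finite_fam F" and A: "A \<subseteq> F" "antichain A"
  shows "\<exists>A' \<subseteq> down_fam F. antichain A' \<and> 2 ^ (card A div 2) \<le> card A'"
proof -
  obtain h where h: "h ` Pow A \<subseteq> down_fam F"
    "\<And>B B'. B \<subseteq> A \<Longrightarrow> B' \<subseteq> A \<Longrightarrow> h B \<subseteq> h B' \<Longrightarrow> B \<subseteq> B'"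
    using antichain_embed_Pow[OF assms] by metis
  have finA: "finite A" using A F finite_subset by (auto simp: finite_fam_def)
  define w where "w = card A div 2"
  define M where "M = {B. B \<subseteq> A \<and> card B = w}"
  have eq: "B = B'" if "B \<in> M" "B' \<in> M" "h B \<subseteq> h B'" for B B'
  proof -
    have "B \<subseteq> B'" "card B = card B'" "finite B'"
      using that h(2) finA by (auto simp: M_def intro: finite_subset)
    then show ?thesis by (simp add: card_subset_eq)
  qed
  have "h ` M \<subseteq> down_fam F" using h(1) by (auto simp: M_def)
  moreover have "antichain (h ` M)" unfolding antichain_def using eq by blast
  moreover have "card (h ` M) = card A choose w"
    using eq n_subsets[OF finA, of w] card_image[of h M] by (auto simp: inj_on_def M_def)
  moreover have "2 ^ w \<le> card A choose w"
  proof -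
    \<comment> \<open>Since \<open>w\<close> is at most half of \<open>card A\<close>, the ratio is
      at least \<open>2\<close>; \<open>w = 0\<close> is treated apart because of the
      division.\<close>
    have "(2::real) ^ w \<le> (real (card A) / real w) ^ w"
    proof (cases "w = 0")
      case False
      then have "2 \<le> real (card A) / real w" unfolding w_def
        by (simp add: field_simps)
      then show ?thesis by (intro power_mono) auto
    qed simp
    also have "\<dots> \<le> real (card A choose w)"
      using binomial_ge_n_over_k_pow_k[of w "card A", where 'a = real] by (simp add: w_def)
    finally show ?thesis by (metis of_nat_le_iff of_nat_numeral of_nat_power)
  qed
  ultimately show ?thesis unfolding w_def by (intro exI[of _ "h ` M"]) simp
qed

section \<open>Tower bounds\<close>

lemma tower_nonneg: "x \<ge> 0 \<Longrightarrow> tower j x \<ge> 0"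
  by (induction j x rule: tower.induct) auto

lemma tower_Suc: "j \<ge> 1 \<Longrightarrow> tower (Suc j) x = 2 powr tower j x"
  by (cases j) auto

text \<open>The additive constant \<open>8\<close> makes the invariant \<open>2 * T + 8\<close> reproduce itself under
  \<open>w \<mapsto> 2 ^ (w div 2)\<close>, since \<open>2 powr (7 / 2) \<ge> 10\<close>.\<close>

lemma double_tower_step:
  fixes T :: real
  assumes "T \<ge> 0" "2 * T + 8 \<le> real w"
  shows "2 * 2 powr T + 8 \<le> 2 ^ (w div 2)"
proof -
  have "(10::real) \<le> 2 powr (7 / 2)"
  proof (rule power2_le_imp_le)
    have "(2 powr (7 / 2) :: real)\<^sup>2 = 2 powr 7"
      by (simp add: power2_eq_square flip: powr_add)
    also have "\<dots> = 128" using powr_realpow[of "2::real" 7] by simp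
    finally show "(10::real)\<^sup>2 \<le> (2 powr (7 / 2))\<^sup>2" by simp
  qed simp
  moreover have "1 \<le> 2 powr T" using assms(1) by (simp add: ge_one_powr_ge_zero)
  ultimately have "2 * 2 powr T + 8 \<le> 2 powr (7 / 2) * 2 powr T"
    using mult_right_mono[of 10 "2 powr (7 / 2)" "2 powr T"] by linarith
  also have "\<dots> = 2 powr (T + 7 / 2)" by (simp add: powr_add)
  also have "\<dots> \<le> 2 powr real (w div 2)"
  proof (rule powr_mono)
    \<comment> \<open>Rounding costs at most \<open>1 / 2\<close>, so \<open>(2 * T + 8) / 2\<close>
      drops to \<open>T + 7 / 2\<close>, the source of the exponent \<open>7 / 2\<close>.\<close>
    have "w \<le> 2 * (w div 2) + 1" by simp
    then have "real w \<le> 2 * real (w div 2) + 1" by linarith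
    then show "T + 7 / 2 \<le> real (w div 2)" using assms(2) by linarith
  qed simp
  also have "\<dots> = 2 ^ (w div 2)" by (simp add: powr_realpow)
  finally show ?thesis .
qed

text \<open>Iterates \<open>width_down_fam\<close>. The start is the first iterate, which matches
  \<open>tower 1 x = x\<close>.\<close>

lemma width_iterate_ge_tower:
  assumes F: "finite_fam F" and A: "A \<subseteq> down_fam F" "antichain A"
    and x: "x \<ge> 0" "2 * x + 8 \<le> real (card A)"
  shows "\<exists>B \<subseteq> (down_fam ^^ Suc j) F. antichain B \<and> 2 * tower (Suc j) x + 8 \<le> real (card B)"
proof (induction j)
  case 0
  then show ?case using A x by auto
next
  case (Suc j)
  then obtain B where B: "B \<subseteq> (down_fam ^^ Suc j) F" "antichain B"
    "2 * tower (Suc j) x + 8 \<le> real (card B)" by blast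
  obtain B' where B': "B' \<subseteq> down_fam ((down_fam ^^ Suc j) F)" "antichain B'"
    "2 ^ (card B div 2) \<le> card B'"
    using width_down_fam[OF finite_fam_iterate[OF F] B(1,2)] by blast
  have "2 * tower (Suc (Suc j)) x + 8 \<le> 2 ^ (card B div 2)"
    using double_tower_step[OF tower_nonneg[OF x(1)] B(3)] by simp
  also have "\<dots> \<le> real (card B')" using B'(3) by (metis of_nat_le_iff of_nat_numeral of_nat_power)
  finally show ?case using B' by auto
qed

text \<open>Width is followed up to iterate \<open>k - 2\<close>; the last iteration counts all
  \<open>2 ^ card B\<close> down-sets.\<close>

lemma mono_path_number_ge_tower:
  assumes k: "k \<ge> 3" and q: "q \<ge> 2" and n: "n \<ge> 4 * k"
  shows "tower (k - 1) (1 / (10 * real (q - 1) * 2 ^ (q - 1)) * real n ^ (q - 1))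
    \<le> real (mono_path_number k q n)"
proof -
  define m where "m = n - k + 1"
  define x where "x = 1 / (10 * real (q - 1) * 2 ^ (q - 1)) * real n ^ (q - 1)"
  have k2: "Suc (k - 2) = k - 1" and k3: "Suc (k - 3) = k - 2" using k by auto
  have m: "m \<ge> 10" "n \<le> 2 * m" using k n by (auto simp: m_def)
  obtain A where A: "A \<subseteq> down_fam (chain_fam q m)" "antichain A" "m ^ (q - 1) \<le> (q - 1) * card A"
    using width_down_fam_chains[of m q] m q by auto
  have "10 * r \<le> 10 ^ r" if "r \<ge> 1" for r :: nat
    using that by (induction r rule: dec_induct) auto
  from this[of "q - 1"] have "(q - 1) * 10 \<le> 10 ^ (q - 1)" using q by (simp add: mult.commute)
  also have "\<dots> \<le> m ^ (q - 1)" using m by (intro power_mono) auto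
  finally have "(q - 1) * 10 \<le> (q - 1) * card A" using A(3) by linarith
  then have w: "card A \<ge> 10" using q by simp
  have "real n ^ (q - 1) \<le> (2 * real m) ^ (q - 1)" using m by (intro power_mono) auto
  also have "\<dots> = 2 ^ (q - 1) * real (m ^ (q - 1))" by (simp add: power_mult_distrib)
  also have "\<dots> \<le> 2 ^ (q - 1) * real ((q - 1) * card A)"
    using A(3) by (intro mult_left_mono) (simp_all only: of_nat_le_iff, simp)
  finally have "10 * x \<le> real (card A)" using q by (simp add: x_def field_simps)
  moreover have x0: "x \<ge> 0" by (simp add: x_def)
  \<comment> \<open>From \<open>10 * x \<le> card A\<close> and \<open>10 \<le> card A\<close>, the
    terms \<open>2 * x\<close> and \<open>8\<close> take at most one fifth and four fifths of
    \<open>card A\<close>. This is where the \<open>10\<close> in the constant is used.\<close>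
  ultimately have "2 * x + 8 \<le> real (card A)" using w by linarith
  from width_iterate_ge_tower[OF finite_fam_chains A(1,2) x0 this, of "k - 3"]
  obtain B where B: "B \<subseteq> (down_fam ^^ (k - 2)) (chain_fam q m)" "antichain B"
    "2 * tower (k - 2) x + 8 \<le> real (card B)"
    unfolding k3 by blast
  have "tower (k - 1) x = 2 powr tower (k - 2) x"
    using tower_Suc[of "k - 2" x] k by (simp add: k2)
  also have "\<dots> \<le> 2 powr real (card B)"
    using B(3) tower_nonneg[OF x0, of "k - 2"] by (intro powr_mono) linarith+
  also have "\<dots> = real (2 ^ card B)" by (simp add: powr_realpow)
  also have "\<dots> \<le> real (card ((down_fam ^^ (k - 1)) (chain_fam q m)))"
    using card_down_fam_ge[OF finite_fam_iterate[OF finite_fam_chains] B(1,2)] k2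
    by (metis comp_apply funpow.simps(2) of_nat_le_iff)
  also have "\<dots> \<le> real (mono_path_number k q n)"
    using mono_path_number_eq[of k n q] k n by (simp add: m_def)
  finally show ?thesis by (simp only: x_def)
qed

text \<open>The summand \<open>1\<close> survives each step because
  \<open>2 ^ a + 1 \<le> 2 ^ (a + 1)\<close>, and it is the \<open>1\<close> in
  \<open>mono_path_number_eq\<close>.\<close>

lemma card_iterate_le_tower:
  assumes F: "finite_fam F" and "real (card ((down_fam ^^ 2) F)) + 1 \<le> tower 2 x"
  shows "real (card ((down_fam ^^ (j + 2)) F)) + 1 \<le> tower (j + 2) x"
proof (induction j)
  case 0
  then show ?case using assms(2) by (simp only: add_0)
next
  case (Suc j)
  let ?G = "(down_fam ^^ (j + 2)) F"
  have "card (down_fam ?G) + 1 \<le> 2 ^ card ?G + 1"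
    using card_down_fam_le[OF finite_fam_iterate[OF F], of "j + 2"] by (simp only: add_le_mono1)
  also have "\<dots> \<le> 2 ^ (card ?G + 1)" by simp
  finally have "real (card (down_fam ?G) + 1) \<le> real (2 ^ (card ?G + 1))"
    by (simp only: of_nat_le_iff)
  then have "real (card (down_fam ?G)) + 1 \<le> 2 ^ (card ?G + 1)" by simp
  also have "\<dots> = 2 powr (real (card ?G) + 1)"
    using powr_realpow[of "2::real" "card ?G + 1"] by (simp add: add.commute)
  also have "\<dots> \<le> 2 powr tower (j + 2) x" using Suc by (intro powr_mono) auto
  finally show ?case by simp
qed

lemma mono_path_number_le_tower:
  assumes k: "k \<ge> 3" and q: "q \<ge> 2" and n: "n \<ge> 4 * k"
  shows "real (mono_path_number k q n) \<le> tower (k - 1) (real n ^ (q - 1) * log 2 (real n))"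
proof -
  define m where "m = n - k + 1"
  define x where "x = real n ^ (q - 1) * log 2 (real n)"
  have k3: "k - 3 + 2 = k - 1" using k by simp
  have m: "m \<ge> 1" "m + 2 \<le> n" using k n by (auto simp: m_def)
  \<comment> \<open>Absorbs the summand \<open>1\<close> by raising the base to
    \<open>m + 2\<close>, which is at most \<open>n\<close> because
    \<open>k \<ge> 3\<close>.\<close>
  have suc: "b ^ e + 1 \<le> (b + 1) ^ e" if "e \<ge> 1" for b e :: nat
    using that
  proof (induction e rule: dec_induct)
    case (step e)
    have "b ^ Suc e + 1 \<le> (b + 1) * (b ^ e + 1)" by (simp add: algebra_simps)
    also have "\<dots> \<le> (b + 1) * (b + 1) ^ e" using step by (intro mult_le_mono) auto
    finally show ?case by simp
  qed simp
  have "card (down_fam (down_fam (chain_fam q m))) + 1 \<le> (m + 1) ^ (m ^ (q - 1)) + 1"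
    using card_down_fam_2_chains_le[of m q] m q by simp
  also have "\<dots> \<le> (m + 1 + 1) ^ (m ^ (q - 1))" using m by (intro suc) simp
  also have "\<dots> \<le> n ^ (m ^ (q - 1))" using m by (intro power_mono) auto
  also have "\<dots> \<le> n ^ (n ^ (q - 1))" using m by (intro power_increasing power_mono) auto
  finally have "real (card (down_fam (down_fam (chain_fam q m)))) + 1 \<le> real (n ^ (n ^ (q - 1)))"
    by linarith
  also have "\<dots> = real n powr (real n ^ (q - 1))"
    using m by (simp add: powr_realpow flip: of_nat_power)
  also have "\<dots> = 2 powr x"
    using m by (simp add: x_def powr_def log_def)
  also have "\<dots> = tower 2 x" by (simp add: numeral_2_eq_2)
  finally have "real (card ((down_fam ^^ 2) (chain_fam q m))) + 1 \<le> tower 2 x"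
    by (simp add: numeral_2_eq_2)
  from card_iterate_le_tower[OF finite_fam_chains this, of "k - 3"]
  have "real (card ((down_fam ^^ (k - 1)) (chain_fam q m))) + 1 \<le> tower (k - 1) x"
    using k by (simp only: k3)
  then show ?thesis
    using mono_path_number_eq[of k n q] k n by (simp add: m_def x_def)
qed

theorem theorem3:
  fixes k q :: nat
  assumes "k \<ge> 3" and "q \<ge> 2"
  shows "\<exists>c c' :: real. c > 0 \<and> c' > 0 \<and>
    (\<forall>n :: nat. n \<ge> 4 * k \<longrightarrow>
       tower (k - 1) (c * real n ^ (q - 1)) \<le> real (mono_path_number k q n) \<and>
       real (mono_path_number k q n) \<le> tower (k - 1) (c' * real n ^ (q - 1) * log 2 (real n)))"
proof (intro exI conjI allI impI)
  \<comment> \<open>The values of \<open>c\<close> and \<open>c'\<close> are fixed here: the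
    constant of the lower bound and \<open>1\<close>.\<close>
  show "1 / (10 * real (q - 1) * 2 ^ (q - 1)) > 0" using assms by simp
  show "(1::real) > 0" by simp
  fix n assume n: "n \<ge> 4 * k"
  show "tower (k - 1) (1 / (10 * real (q - 1) * 2 ^ (q - 1)) * real n ^ (q - 1))
    \<le> real (mono_path_number k q n)"
    by (rule mono_path_number_ge_tower[OF assms n])
  show "real (mono_path_number k q n) \<le> tower (k - 1) (1 * real n ^ (q - 1) * log 2 (real n))"
    using mono_path_number_le_tower[OF assms n] by simp
qed

end
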